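(* Let $G$ be a simple mixed graph on $n$ vertices with $e(G)$ edges and $a(G)$ arcs. Then the coefficient of $x^{2n-2}$ in the characteristic polynomial $\det(xI-\mathcal{I}(G))$ of the integrated adjacency matrix $\mathcal{I}(G)$ is $-2e(G)-a(G)$.
   Context: A mixed graph $G$ has a finite nonempty vertex set $V_G=\{v_1,\dots,v_n\}$, a finite set $E_G$ of (undirected) edges, each joining an unordered pair of vertices $\{u,v\}$ (a loop if $u=v$), and a finite set $\vec E_G$ of arcs, each going from $u$ to $v$ for an ordered pair $(u,v)$ of vertices (a directed loop if $u=v$); multiple edges, loops, arcs and directed loops are allowed. $G$ is simple if it has no loops, no directed loops, at most one edge joining any two vertices, and at most one arc from $u$ to $v$ for each ordered pair $(u,v)$ (an edge and arcs in both directions may coexist on the same pair of vertices). The integrated adjacency matrix $\mathcal{I}(G)$ is the real symmetric $2n\times 2n$ matrix $\begin{bmatrix}A&D\\ D^T&A\end{bmatrix}$, where $A_{ij}$ ($i\neq j$) is the number of edges joining $v_i$ and $v_j$, $A_{ii}$ is twice the number of loops at $v_i$, and $D_{ij}$ is the number of arcs from $v_i$ to $v_j$. *)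

theory Defs
  imports "HOL-Library.Uprod" "Jordan_Normal_Form.Char_Poly"
begin

text \<open>Edges and arcs are separate objects with their own incidence maps, so that parallel edges and
  parallel arcs are possible. An edge \<open>e\<close> is a loop at \<open>u\<close> if \<open>edge_ends G e = Upair u u\<close>.\<close>

record ('v, 'e, 'a) mixed_graph_data =
  verts :: "'v set"
  edges :: "'e set"
  edge_ends :: "'e \<Rightarrow> 'v uprod"
  arcs :: "'a set"
  arc_tail :: "'a \<Rightarrow> 'v"
  arc_head :: "'a \<Rightarrow> 'v"

definition edges_joining :: "('v, 'e, 'a) mixed_graph_data \<Rightarrow> 'v \<Rightarrow> 'v \<Rightarrow> 'e set" where
  "edges_joining G u v = {e \<in> edges G. edge_ends G e = Upair u v}"

definition arcs_from_to :: "('v, 'e, 'a) mixed_graph_data \<Rightarrow> 'v \<Rightarrow> 'v \<Rightarrow> 'a set" where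
  "arcs_from_to G u v = {a \<in> arcs G. arc_tail G a = u \<and> arc_head G a = v}"

locale mixed_graph =
  fixes G :: "('v, 'e, 'a) mixed_graph_data"
  assumes finite_verts: "finite (verts G)"
    and verts_nonempty: "verts G \<noteq> {}"
    and finite_edges: "finite (edges G)"
    and finite_arcs: "finite (arcs G)"
    and edge_ends_in_verts: "e \<in> edges G \<Longrightarrow> set_uprod (edge_ends G e) \<subseteq> verts G"
    and arc_tail_in_verts: "a \<in> arcs G \<Longrightarrow> arc_tail G a \<in> verts G"
    and arc_head_in_verts: "a \<in> arcs G \<Longrightarrow> arc_head G a \<in> verts G"

locale simple_mixed_graph = mixed_graph G
  for G :: "('v, 'e, 'a) mixed_graph_data" +
  assumes no_loops: "u \<in> verts G \<Longrightarrow> edges_joining G u u = {}"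
    and no_directed_loops: "u \<in> verts G \<Longrightarrow> arcs_from_to G u u = {}"
    and no_multi_edges:
      "\<lbrakk>u \<in> verts G; v \<in> verts G; u \<noteq> v\<rbrakk> \<Longrightarrow> card (edges_joining G u v) \<le> 1"
    and no_multi_arcs:
      "\<lbrakk>u \<in> verts G; v \<in> verts G\<rbrakk> \<Longrightarrow> card (arcs_from_to G u v) \<le> 1"

text \<open>In the matrices below, \<open>v\<close> enumerates the vertices with indices starting from 0, that is,
  \<open>bij_betw v {..<n} (verts G)\<close> for \<open>n = card (verts G)\<close>.\<close>

definition edge_matrix :: "('v, 'e, 'a) mixed_graph_data \<Rightarrow> (nat \<Rightarrow> 'v) \<Rightarrow> real mat" where
  "edge_matrix G v = mat (card (verts G)) (card (verts G)) (\<lambda>(i, j).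
     if i = j then 2 * real (card (edges_joining G (v i) (v i)))
     else real (card (edges_joining G (v i) (v j))))"

definition arc_matrix :: "('v, 'e, 'a) mixed_graph_data \<Rightarrow> (nat \<Rightarrow> 'v) \<Rightarrow> real mat" where
  "arc_matrix G v = mat (card (verts G)) (card (verts G)) (\<lambda>(i, j).
     real (card (arcs_from_to G (v i) (v j))))"

definition integrated_adjacency_matrix ::
    "('v, 'e, 'a) mixed_graph_data \<Rightarrow> (nat \<Rightarrow> 'v) \<Rightarrow> real mat" where
  "integrated_adjacency_matrix G v =
     four_block_mat (edge_matrix G v) (arc_matrix G v)
       (transpose_mat (arc_matrix G v)) (edge_matrix G v)"

end

theory Submission
  imports Defs
begin

text \<open>
  Both sides come from the Leibniz expansion of \<open>det (x I - M)\<close>. If the \<open>N \<times> N\<close> matrix \<open>M\<close> has zero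
  diagonal, then the permutation \<open>p\<close> contributes a constant times \<open>x\<close> to the number of fixed points
  of \<open>p\<close>. So the coefficient of \<open>x\<close> to the power \<open>N - 2\<close> collects the permutations moving exactly
  two points, which are the transpositions \<open>(i j)\<close>; each has sign \<open>-1\<close> and contributes
  \<open>- M\<^sub>i\<^sub>j M\<^sub>j\<^sub>i\<close> (lemma \<open>coeff_char_poly_zero_diag\<close>).

  For the integrated adjacency matrix of a simple mixed graph, the diagonal vanishes because there are
  no loops, and all entries are \<open>0\<close> or \<open>1\<close> because there are no parallel edges or arcs. By symmetry,
  \<open>M\<^sub>i\<^sub>j M\<^sub>j\<^sub>i = M\<^sub>i\<^sub>j\<close>, so twice the coefficient is minus the sum of all entries of \<open>M\<close>. In that sum, each
  of the two copies of \<open>A\<close> counts every edge twice, once per orientation, and each of \<open>D\<close> and its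
  transpose counts every arc once. The total is \<open>4 e + 2 a\<close>, and half of it, negated, is \<open>- 2 e - a\<close>.
\<close>

section \<open>Permutations moving two points\<close>

text \<open>Requiring \<open>i < j\<close> names each transposition once, so that a sum over these permutations becomes
  a sum over index pairs.\<close>

lemma permutes_two_moved_eq_transpositions:
  fixes S :: "'a :: linorder set"
  shows "{p. p permutes S \<and> card {i. p i \<noteq> i} = 2} =
    (\<lambda>(i, j). Transposition.transpose i j) ` {(i, j). i \<in> S \<and> j \<in> S \<and> i < j}"
proof (intro equalityI subsetI)
  fix p assume "p \<in> {p. p permutes S \<and> card {i. p i \<noteq> i} = 2}"
  then have p: "p permutes S" and "card {i. p i \<noteq> i} = 2"
    by auto
  then obtain a b where ab: "{i. p i \<noteq> i} = {a, b}" "a \<noteq> b"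
    unfolding card_2_iff by blast
  obtain x y where xy: "{i. p i \<noteq> i} = {x, y}" "x < y"
  proof (cases a b rule: linorder_cases)
    case greater
    then show ?thesis
      using that[of b a] ab(1) by (simp add: insert_commute)
  qed (use ab that in blast)+
  have "p permutes {x, y}"
    by (rule permutes_superset[OF p]) (use xy in blast)
  moreover have "p \<noteq> id"
    using xy by auto
  ultimately have "p = Transposition.transpose x y"
    by (simp add: permutes_doubleton_iff)
  moreover have "x \<in> S" "y \<in> S"
    using xy permutes_not_in[OF p] by blast+
  ultimately show "p \<in> (\<lambda>(i, j). Transposition.transpose i j) ` {(i, j). i \<in> S \<and> j \<in> S \<and> i < j}"
    using xy(2) by auto
next
  fix p assume "p \<in> (\<lambda>(i, j). Transposition.transpose i j) ` {(i, j). i \<in> S \<and> j \<in> S \<and> i < j}"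
  then obtain i j where p: "p = Transposition.transpose i j" "i \<in> S" "j \<in> S" "i < j"
    by auto
  then have "{k. p k \<noteq> k} = {i, j}"
    by (auto simp: Transposition.transpose_def)
  with p show "p \<in> {p. p permutes S \<and> card {i. p i \<noteq> i} = 2}"
    by (simp add: permutes_swap_id)
qed

lemma inj_on_transpose_ordered_pairs:
  "inj_on (\<lambda>(i, j). Transposition.transpose i j) {(i, j). i \<in> S \<and> j \<in> S \<and> i < (j :: 'a :: linorder)}"
proof (rule inj_onI, clarsimp)
  fix i j k l :: 'a
  assume "i < j" "k < l" and eq: "Transposition.transpose i j = Transposition.transpose k l"
  have moved: "{x. Transposition.transpose a b x \<noteq> x} = {a, b}" if "a < b" for a b :: 'a
    using that by (auto simp: Transposition.transpose_def)
  have "{i, j} = {k, l}"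
    using moved[OF \<open>i < j\<close>] moved[OF \<open>k < l\<close>] eq by simp
  then show "i = k \<and> j = l"
    using \<open>i < j\<close> \<open>k < l\<close> by (auto simp: doubleton_eq_iff)
qed

section \<open>The second coefficient below the leading one\<close>

lemma char_poly_matrix_index:
  assumes "A \<in> carrier_mat N N" "i < N" "j < N"
  shows "char_poly_matrix A $$ (i, j) = (if i = j then [:- A $$ (i, i), 1:] else [:- A $$ (i, j):])"
  using assms by (auto simp: char_poly_matrix_def)

text \<open>A fixed point of \<open>p\<close> selects a diagonal entry, which is \<open>x\<close>; every other factor is constant.\<close>

lemma leibniz_term_zero_diag:
  fixes A :: "'a :: comm_ring_1 mat"
  assumes A: "A \<in> carrier_mat N N" and zero: "\<And>i. i < N \<Longrightarrow> A $$ (i, i) = 0"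
    and p: "p permutes {0..<N}"
  shows "(\<Prod>i = 0..<N. char_poly_matrix A $$ (i, p i)) =
    monom (\<Prod>i \<in> {i. p i \<noteq> i}. - A $$ (i, p i)) (N - card {i. p i \<noteq> i})"
proof -
  let ?moved = "{i. p i \<noteq> i}"
  have moved: "?moved \<subseteq> {0..<N}"
    using permutes_not_in[OF p] by blast
  then have fin: "finite ?moved"
    using finite_subset by blast
  have pN: "p i < N" if "i < N" for i
    using permutes_in_image[OF p, of i] that by simp
  have "(\<Prod>i = 0..<N. char_poly_matrix A $$ (i, p i)) =
    (\<Prod>i \<in> {0..<N} - ?moved. char_poly_matrix A $$ (i, p i)) *
    (\<Prod>i \<in> ?moved. char_poly_matrix A $$ (i, p i))"
    using moved by (intro prod.subset_diff) auto
  also have "(\<Prod>i \<in> {0..<N} - ?moved. char_poly_matrix A $$ (i, p i)) =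
    (\<Prod>i \<in> {0..<N} - ?moved. monom 1 1)"
    by (rule prod.cong) (auto simp: char_poly_matrix_index[OF A] zero monom_altdef)
  also have "\<dots> = monom 1 (N - card ?moved)"
    using moved fin by (simp add: card_Diff_subset monom_power)
  also have "(\<Prod>i \<in> ?moved. char_poly_matrix A $$ (i, p i)) =
    (\<Prod>i \<in> ?moved. [:- A $$ (i, p i):])"
    using moved by (intro prod.cong) (auto simp: char_poly_matrix_index[OF A] pN subset_iff)
  also have "\<dots> = [:\<Prod>i \<in> ?moved. - A $$ (i, p i):]"
    using fin by (induction rule: finite_induct) (auto simp: one_pCons)
  finally show ?thesis
    by (simp add: smult_monom)
qed

lemma coeff_signof_mult: "coeff (signof p * q) k = signof p * coeff q k"
  by (cases p rule: sign_cases) simp_all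

text \<open>Only transpositions have exactly \<open>N - 2\<close> fixed points, so only their Leibniz terms reach this
  coefficient. Each summand below is minus the \<open>2 \<times> 2\<close> principal minor on the rows \<open>i\<close> and \<open>j\<close>, whose
  diagonal product vanishes here.\<close>

lemma coeff_char_poly_zero_diag:
  fixes A :: "'a :: comm_ring_1 mat"
  assumes A: "A \<in> carrier_mat N N" and zero: "\<And>i. i < N \<Longrightarrow> A $$ (i, i) = 0" and N: "2 \<le> N"
  shows "coeff (char_poly A) (N - 2) =
    - (\<Sum>(i, j) \<in> {(i, j). i < N \<and> j < N \<and> i < j}. A $$ (i, j) * A $$ (j, i))"
proof -
  let ?P = "{p. p permutes {0..<N}}"
  let ?T = "{p. p permutes {0..<N} \<and> card {i. p i \<noteq> i} = 2}"
  let ?c = "\<lambda>p. signof p * (\<Prod>i \<in> {i. p i \<noteq> i}. - A $$ (i, p i))"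
  have "coeff (char_poly A) (N - 2) =
    (\<Sum>p \<in> ?P. signof p * coeff (\<Prod>i = 0..<N. char_poly_matrix A $$ (i, p i)) (N - 2))"
    unfolding char_poly_def det_def'[OF char_poly_matrix_closed[OF A]] coeff_sum coeff_signof_mult ..
  also have "\<dots> = (\<Sum>p \<in> ?P. if card {i. p i \<noteq> i} = 2 then ?c p else 0)"
  proof (rule sum.cong[OF refl])
    fix p assume "p \<in> ?P"
    then have p: "p permutes {0..<N}"
      by simp
    then have "{i. p i \<noteq> i} \<subseteq> {0..<N}"
      using permutes_not_in[OF p] by blast
    then have "card {i. p i \<noteq> i} \<le> N"
      using card_mono[of "{0..<N}"] by fastforce
    then have "N - card {i. p i \<noteq> i} = N - 2 \<longleftrightarrow> card {i. p i \<noteq> i} = 2"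
      using N by auto
    then show "signof p * coeff (\<Prod>i = 0..<N. char_poly_matrix A $$ (i, p i)) (N - 2) =
        (if card {i. p i \<noteq> i} = 2 then ?c p else 0)"
      by (simp add: leibniz_term_zero_diag[OF A zero p])
  qed
  also have "\<dots> = (\<Sum>p \<in> ?T. ?c p)"
    by (simp add: sum.If_cases finite_permutations Collect_conj_eq)
  also have "\<dots> = (\<Sum>(i, j) \<in> {(i, j). i < N \<and> j < N \<and> i < j}. ?c (Transposition.transpose i j))"
    unfolding permutes_two_moved_eq_transpositions
    by (subst sum.reindex[OF inj_on_transpose_ordered_pairs])
      (simp add: case_prod_unfold)
  also have "\<dots> = (\<Sum>(i, j) \<in> {(i, j). i < N \<and> j < N \<and> i < j}. - (A $$ (i, j) * A $$ (j, i)))"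
  proof (rule sum.cong[OF refl], clarify)
    fix i j :: nat assume "i < j"
    then have "{k. Transposition.transpose i j k \<noteq> k} = {i, j}"
      by (auto simp: Transposition.transpose_def)
    then show "?c (Transposition.transpose i j) = - (A $$ (i, j) * A $$ (j, i))"
      using \<open>i < j\<close> by (simp add: sign_swap_id)
  qed
  finally show ?thesis
    by (simp add: sum_negf case_prod_unfold)
qed

lemma sum_symmetric_zero_diag:
  fixes f :: "nat \<Rightarrow> nat \<Rightarrow> 'a :: comm_ring_1"
  assumes sym: "\<And>i j. i < N \<Longrightarrow> j < N \<Longrightarrow> f i j = f j i" and zero: "\<And>i. i < N \<Longrightarrow> f i i = 0"
  shows "(\<Sum>i<N. \<Sum>j<N. f i j) = 2 * (\<Sum>(i, j) \<in> {(i, j). i < N \<and> j < N \<and> i < j}. f i j)"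
proof -
  let ?U = "{(i, j). i < N \<and> j < N \<and> i < j}" and ?L = "{(i, j). i < N \<and> j < N \<and> j < i}"
  let ?I = "{(i, j). i < N \<and> j < N \<and> i = j}"
  have sq: "{..<N} \<times> {..<N} = ?U \<union> ?L \<union> ?I"
    by auto
  have "finite ({..<N} \<times> {..<N})"
    by simp
  then have fin: "finite ?U" "finite ?L" "finite ?I"
    unfolding sq finite_Un by blast+
  have "(\<Sum>i<N. \<Sum>j<N. f i j) = (\<Sum>(i, j) \<in> ?U \<union> ?L \<union> ?I. f i j)"
    unfolding sum.cartesian_product sq ..
  also have "\<dots> = (\<Sum>(i, j) \<in> ?U. f i j) + (\<Sum>(i, j) \<in> ?L. f i j) + (\<Sum>(i, j) \<in> ?I. f i j)"
  proof -
    have "?U \<inter> ?L = {}" "(?U \<union> ?L) \<inter> ?I = {}"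
      by auto
    with fin show ?thesis
      by (simp only: sum.union_disjoint finite_Un simp_thms)
  qed
  also have "(\<Sum>(i, j) \<in> ?I. f i j) = 0"
    by (rule sum.neutral) (auto simp: zero)
  also have "(\<Sum>(i, j) \<in> ?L. f i j) = (\<Sum>(i, j) \<in> ?U. f i j)"
    by (rule sum.reindex_bij_witness[of _ prod.swap prod.swap]) (auto simp: sym)
  finally show ?thesis
    by simp
qed

section \<open>Counting edges and arcs through matrix entries\<close>

text \<open>Double counting of the pairs related by \<open>R\<close>: it turns a sum of multiplicities over the vertex
  pairs into a sum over the edges or arcs themselves.\<close>

lemma sum_card_double_count:
  assumes "finite E" "finite P"
  shows "(\<Sum>q \<in> P. card {e \<in> E. R e q}) = (\<Sum>e \<in> E. card {q \<in> P. R e q})"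
proof -
  have "(\<Sum>q \<in> P. card {e \<in> E. R e q}) = (\<Sum>q \<in> P. \<Sum>e \<in> E. if R e q then 1 else 0)"
    using assms by (simp flip: sum.inter_filter)
  also have "\<dots> = (\<Sum>e \<in> E. \<Sum>q \<in> P. if R e q then 1 else 0)"
    by (rule sum.swap)
  also have "\<dots> = (\<Sum>e \<in> E. card {q \<in> P. R e q})"
    using assms by (simp flip: sum.inter_filter)
  finally show ?thesis .
qed

lemma edges_joining_commute: "edges_joining G u w = edges_joining G w u"
proof -
  have "Upair u w = Upair w u"
    by simp
  then show ?thesis
    unfolding edges_joining_def by (simp only:)
qed

text \<open>No edge is a loop, so each is counted at exactly two ordered pairs of vertices.\<close>

lemma (in simple_mixed_graph) sum_card_edges_joining:
  "(\<Sum>(u, w) \<in> verts G \<times> verts G. card (edges_joining G u w)) = 2 * card (edges G)"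
proof -
  have two: "card {q \<in> verts G \<times> verts G. edge_ends G e = Upair (fst q) (snd q)} = 2"
    if e: "e \<in> edges G" for e
  proof -
    obtain x y where xy: "edge_ends G e = Upair x y"
      by (cases "edge_ends G e")
    then have V: "x \<in> verts G" "y \<in> verts G"
      using edge_ends_in_verts[OF e] by auto
    have "x \<noteq> y"
      using no_loops[OF V(1)] e xy by (auto simp: edges_joining_def)
    have "{q \<in> verts G \<times> verts G. edge_ends G e = Upair (fst q) (snd q)} = {(x, y), (y, x)}"
      using V xy by auto
    then show ?thesis
      using \<open>x \<noteq> y\<close> by simp
  qed
  have "(\<Sum>(u, w) \<in> verts G \<times> verts G. card (edges_joining G u w)) =
    (\<Sum>e \<in> edges G. card {q \<in> verts G \<times> verts G. edge_ends G e = Upair (fst q) (snd q)})"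
    unfolding edges_joining_def case_prod_unfold
    by (rule sum_card_double_count) (simp_all add: finite_edges finite_verts)
  then show ?thesis
    using two by simp
qed

lemma (in mixed_graph) sum_card_arcs_from_to:
  "(\<Sum>(u, w) \<in> verts G \<times> verts G. card (arcs_from_to G u w)) = card (arcs G)"
proof -
  have one: "card {q \<in> verts G \<times> verts G. arc_tail G a = fst q \<and> arc_head G a = snd q} = 1"
    if a: "a \<in> arcs G" for a
  proof -
    have "{q \<in> verts G \<times> verts G. arc_tail G a = fst q \<and> arc_head G a = snd q} =
      {(arc_tail G a, arc_head G a)}"
      using arc_tail_in_verts[OF a] arc_head_in_verts[OF a] by auto
    then show ?thesis
      by simp
  qed
  have "(\<Sum>(u, w) \<in> verts G \<times> verts G. card (arcs_from_to G u w)) =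
    (\<Sum>a \<in> arcs G. card {q \<in> verts G \<times> verts G. arc_tail G a = fst q \<and> arc_head G a = snd q})"
    unfolding arcs_from_to_def case_prod_unfold
    by (rule sum_card_double_count) (simp_all add: finite_arcs finite_verts)
  then show ?thesis
    using one by simp
qed

lemma sum_enumerated_pairs:
  fixes v :: "nat \<Rightarrow> 'v" and f :: "'v \<Rightarrow> 'v \<Rightarrow> nat"
  assumes "bij_betw v {..<n} V"
  shows "(\<Sum>i<n. \<Sum>j<n. real (f (v i) (v j))) = real (\<Sum>(u, w) \<in> V \<times> V. f u w)"
proof -
  have "(\<Sum>i<n. \<Sum>j<n. real (f (v i) (v j))) = (\<Sum>i<n. \<Sum>w \<in> V. real (f (v i) w))"
    by (intro sum.cong refl sum.reindex_bij_betw[OF assms])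
  also have "\<dots> = (\<Sum>u \<in> V. \<Sum>w \<in> V. real (f u w))"
    by (rule sum.reindex_bij_betw[OF assms])
  finally show ?thesis
    by (simp add: sum.cartesian_product case_prod_unfold)
qed

lemma sum_lessThan_add:
  fixes f :: "nat \<Rightarrow> 'a :: comm_monoid_add"
  shows "(\<Sum>i<n + m. f i) = (\<Sum>i<n. f i) + (\<Sum>i<m. f (n + i))"
  by (induction m) (simp_all add: add.assoc)

section \<open>The integrated adjacency matrix of a simple mixed graph\<close>

lemma four_block_symmetric_index:
  assumes A: "A \<in> carrier_mat n n" and D: "D \<in> carrier_mat n n" and "i < n" "j < n"
  shows "four_block_mat A D (transpose_mat D) A $$ (i, j) = A $$ (i, j)"
    and "four_block_mat A D (transpose_mat D) A $$ (i, n + j) = D $$ (i, j)"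
    and "four_block_mat A D (transpose_mat D) A $$ (n + i, j) = D $$ (j, i)"
    and "four_block_mat A D (transpose_mat D) A $$ (n + i, n + j) = A $$ (i, j)"
  using assms by auto

theorem theorem4p3:
  fixes G :: "('v, 'e, 'a) mixed_graph_data"
    and v :: "nat \<Rightarrow> 'v"
    and n :: nat
  assumes "simple_mixed_graph G"
    and "card (verts G) = n"
    and "bij_betw v {..<n} (verts G)"
  shows "coeff (char_poly (integrated_adjacency_matrix G v)) (2 * n - 2) =
    - 2 * real (card (edges G)) - real (card (arcs G))"
proof -
  interpret simple_mixed_graph G
    by (rule assms(1))
  define A where "A = edge_matrix G v"
  define D where "D = arc_matrix G v"
  define M where "M = integrated_adjacency_matrix G v"
  have A: "A \<in> carrier_mat n n" and D: "D \<in> carrier_mat n n"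
    by (simp_all add: A_def D_def edge_matrix_def arc_matrix_def assms(2))
  have M_block: "M = four_block_mat A D (transpose_mat D) A"
    by (simp add: M_def integrated_adjacency_matrix_def A_def D_def)
  have M: "M \<in> carrier_mat (n + n) (n + n)"
    unfolding M_block using A D by simp
  note M_index = four_block_symmetric_index[OF A D, folded M_block]
  have vV: "v i \<in> verts G" if "i < n" for i
    using assms(3) that by (auto simp: bij_betw_def)
  have A_index: "A $$ (i, j) = real (card (edges_joining G (v i) (v j)))" if "i < n" "j < n" for i j
    using that no_loops[OF vV] by (simp add: A_def edge_matrix_def assms(2))
  have D_index: "D $$ (i, j) = real (card (arcs_from_to G (v i) (v j)))" if "i < n" "j < n" for i j
    using that by (simp add: D_def arc_matrix_def assms(2))

  have A_01: "A $$ (i, j) \<in> {0, 1}" if "i < n" "j < n" for i j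
    using no_multi_edges[OF vV vV, OF that] no_loops[OF vV, OF that(1)]
    by (cases "v i = v j") (auto simp: A_index that)
  have D_01: "D $$ (i, j) \<in> {0, 1}" if "i < n" "j < n" for i j
    using no_multi_arcs[OF vV vV, OF that] by (auto simp: D_index that)
  have A_sym: "A $$ (i, j) = A $$ (j, i)" if "i < n" "j < n" for i j
    using that by (simp add: A_index edges_joining_commute[of G "v i" "v j"])
  have A_diag: "A $$ (i, i) = 0" if "i < n" for i
    using that no_loops[OF vV] by (simp add: A_index)

  have split: "i < n \<or> (\<exists>i'<n. i = n + i')" if "i < n + n" for i
    using that by (cases "i < n") (auto intro!: exI[of _ "i - n"])
  have M_sym: "M $$ (i, j) = M $$ (j, i)" if "i < n + n" "j < n + n" for i j
    using split[OF that(1)] split[OF that(2)] by (auto simp: M_index A_sym)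
  have M_diag: "M $$ (i, i) = 0" if "i < n + n" for i
    using split[OF that] by (auto simp: M_index A_diag)
  have M_01: "M $$ (i, j) \<in> {0, 1}" if "i < n + n" "j < n + n" for i j
    using split[OF that(1)] split[OF that(2)]
    by (elim disjE exE conjE) (use A_01 D_01 in \<open>simp_all add: M_index\<close>)

  have sumA: "(\<Sum>i<n. \<Sum>j<n. A $$ (i, j)) = 2 * real (card (edges G))"
    using sum_enumerated_pairs[OF assms(3), of "\<lambda>u w. card (edges_joining G u w)"]
    by (simp add: A_index sum_card_edges_joining)
  have sumD: "(\<Sum>i<n. \<Sum>j<n. D $$ (i, j)) = real (card (arcs G))"
    using sum_enumerated_pairs[OF assms(3), of "\<lambda>u w. card (arcs_from_to G u w)"]
    by (simp add: D_index sum_card_arcs_from_to)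
  then have sumDT: "(\<Sum>i<n. \<Sum>j<n. D $$ (j, i)) = real (card (arcs G))"
    by (subst sum.swap)
  have sumM: "(\<Sum>i<n + n. \<Sum>j<n + n. M $$ (i, j)) =
      4 * real (card (edges G)) + 2 * real (card (arcs G))"
    by (simp add: sum_lessThan_add sum.distrib M_index sumA sumD sumDT)

  \<comment> \<open>A graph has a vertex, so \<open>2 * n - 2\<close> is not truncated.\<close>
  have "n \<ge> 1"
    using verts_nonempty finite_verts assms(2) card_gt_0_iff[of "verts G"] by simp
  then have "coeff (char_poly M) (n + n - 2) =
    - (\<Sum>(i, j) \<in> {(i, j). i < n + n \<and> j < n + n \<and> i < j}. M $$ (i, j) * M $$ (j, i))"
    by (intro coeff_char_poly_zero_diag[OF M M_diag]) auto
  also have "\<dots> = - (\<Sum>(i, j) \<in> {(i, j). i < n + n \<and> j < n + n \<and> i < j}. M $$ (i, j))"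
  proof -
    have "M $$ (i, j) * M $$ (j, i) = M $$ (i, j)" if "i < n + n" "j < n + n" for i j
      using M_01[OF that] M_sym[OF that] by auto
    then show ?thesis
      by (intro arg_cong[where f = uminus] sum.cong) auto
  qed
  finally have "2 * coeff (char_poly M) (n + n - 2) = - (\<Sum>i<n + n. \<Sum>j<n + n. M $$ (i, j))"
    using sum_symmetric_zero_diag[of "n + n" "\<lambda>i j. M $$ (i, j)", OF M_sym M_diag] by simp
  then show ?thesis
    unfolding sumM by (simp add: M_def flip: mult_2)
qed

end
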